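(* Fix an integer $r\ge 2$ and a real number $\delta\in(0,\frac14)$. Then there exists a set $A\subseteq\mathbb{N}$ which admits asymptotic density such that $$ \mathsf{d}(A)=\delta^r,\qquad \mathsf{d}^{\star}(A+A)=1,\qquad\text{and}\qquad \mathsf{d}_{\star}(A+A)\le (r+1)(2\delta)^{r-1}. $$
   Context: Here $\mathbb{N}=\{0,1,2,\ldots\}$. For $A\subseteq\mathbb{N}$, the lower and upper asymptotic densities are $$\mathsf{d}_{\star}(A)=\liminf_{N\to\infty}\frac{|A\cap[0,N)|}{N},\qquad \mathsf{d}^{\star}(A)=\limsup_{N\to\infty}\frac{|A\cap[0,N)|}{N}.$$ If $\mathsf{d}_{\star}(A)=\mathsf{d}^{\star}(A)$, then $A$ is said to admit asymptotic density, and the common value is denoted by $\mathsf{d}(A)$. The sumset is $A+A=\{x+y: x\in A,\ y\in A\}$. *)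

theory Defs
  imports "HOL-Library.Extended_Real" "HOL-Library.Liminf_Limsup" "HOL-Library.Set_Algebras"
begin

text \<open>
  The densities take values in \<^typ>\<open>ereal\<close> because \<^const>\<open>liminf\<close> and \<^const>\<open>limsup\<close>
  need a complete lattice. The term at \<open>N = 0\<close> is \<open>0 / 0 = 0\<close> and does not affect either limit.
\<close>

definition lower_density :: "nat set \<Rightarrow> ereal" where
  "lower_density A = liminf (\<lambda>N. ereal (real (card (A \<inter> {0..<N})) / real N))"

definition upper_density :: "nat set \<Rightarrow> ereal" where
  "upper_density A = limsup (\<lambda>N. ereal (real (card (A \<inter> {0..<N})) / real N))"

definition admits_density :: "nat set \<Rightarrow> bool" where
  "admits_density A \<longleftrightarrow> lower_density A = upper_density A"

text \<open>The common value; only meaningful for sets satisfying \<^const>\<open>admits_density\<close>.\<close>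

definition asymptotic_density :: "nat set \<Rightarrow> ereal" where
  "asymptotic_density A = lower_density A"

end

theory Submission
  imports Defs
begin

text \<open>
  Let \<open>Q\<^sub>k = 2 ^ k\<^sup>2\<close> (\<open>modulus\<close>) and \<open>T\<^sub>k = 2 ^ (k\<^sup>2 + k)\<close> (\<open>cutoff\<close>), so that each \<open>Q\<^sub>k\<close> divides the
  next one and \<open>Q\<^sub>k \<lless> T\<^sub>k \<lless> Q\<^sub>k\<^sub>+\<^sub>1\<close>. Say that \<open>n\<close> is \<open>\<theta>\<close>-small at the index \<open>i\<close> if
  \<open>n mod Q\<^sub>i < \<theta> Q\<^sub>i\<close>. Since the ratios \<open>Q\<^sub>i\<^sub>+\<^sub>1 / Q\<^sub>i\<close> tend to infinity, smallness at different
  large indices is nearly independent: being \<open>\<theta>\<close>-small at \<open>s\<close> given large indices has density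
  close to \<open>\<theta> ^ s\<close> (lemma \<open>digit_set_count\<close>).

  In stage \<open>k\<close>, that is on \<open>[T\<^sub>k, T\<^sub>k\<^sub>+\<^sub>1)\<close>, the set \<open>A\<close> consists of the numbers that are
  \<open>\<delta>\<close>-small at the \<open>r\<close> indices of the window \<open>{k - r + 1..k}\<close>. Moreover, in every stage whose
  number is a multiple of \<open>r + 2\<close>, the interval \<open>[T\<^sub>k, T\<^sub>k + Q\<^sub>k)\<close> is added. These intervals are
  negligible and the stages grow fast, so \<open>A\<close> has density \<open>\<delta> ^ r\<close> (\<open>sliding_set_density\<close>).

  If \<open>r + 2\<close> divides \<open>k\<close>, the added interval and the multiples of \<open>Q\<^sub>k\<close>, all of which lie in \<open>A\<close>
  as long as they are in stage \<open>k\<close>, have every number of \<open>[2 T\<^sub>k, T\<^sub>k\<^sub>+\<^sub>1)\<close> as a sum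
  (\<open>sumset_contains_stage\<close>). Hence \<open>A + A\<close> has upper density 1.

  If \<open>r + 2\<close> divides \<open>k + 1\<close> and \<open>k\<close> is large, then a sum in \<open>[2 T\<^sub>k, T\<^sub>k\<^sub>+\<^sub>1)\<close> has a
  summand \<open>y\<close> in stage \<open>k\<close>, which is \<open>\<delta>\<close>-small on the whole window, and a summand \<open>x\<close> in some stage \<open>j \<le> k\<close>. At indices
  \<open>i \<ge> j + 2\<close> the number \<open>x\<close> is \<open>\<delta>\<close>-small because it is itself much less than \<open>Q\<^sub>i\<close>; at the
  indices \<open>i \<le> j\<close> of the window of \<open>k\<close> it is \<open>\<delta>\<close>-small because they belong to the window of
  \<open>j\<close>, while the intervals added up to stage \<open>k\<close> belong to stages \<open>j\<close> below that window. Only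
  \<open>i = j + 1\<close> is lost. So \<open>x + y\<close> is \<open>2\<delta>\<close>-small at all indices of the window but at most one
  (\<open>sumset_subset\<close>), and these sums have density at most about \<open>r (2\<delta>) ^ (r - 1)\<close> up to
  \<open>T\<^sub>k\<^sub>+\<^sub>1\<close> (\<open>sumset_count_le\<close>).
\<close>

section \<open>Counting functions\<close>

text \<open>The number of elements of \<open>P\<close> in \<open>[0, N)\<close>.\<close>

definition count_below :: "nat set \<Rightarrow> nat \<Rightarrow> nat" where
  "count_below P N = card (P \<inter> {0..<N})"

lemma count_below_diff:
  assumes "u \<le> v"
  shows "real (count_below P v) - real (count_below P u) = real (card (P \<inter> {u..<v}))"
proof -
  have "P \<inter> {0..<v} = (P \<inter> {0..<u}) \<union> (P \<inter> {u..<v})" using assms by auto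
  then have "count_below P v = count_below P u + card (P \<inter> {u..<v})"
    unfolding count_below_def by (simp add: card_Un_disjoint disjoint_iff)
  then show ?thesis by simp
qed

lemma card_Int_interval_le: "card (P \<inter> {u..<v}) \<le> v - (u::nat)"
  using card_mono[of "{u..<v}" "P \<inter> {u..<v}"] by simp

lemma count_below_le: "count_below P N \<le> N"
  using card_Int_interval_le[of P 0 N] by (simp add: count_below_def)

lemma count_below_Suc: "count_below P (Suc N) = count_below P N + (if N \<in> P then 1 else 0)"
  by (simp add: count_below_def atLeast0_lessThan_Suc Int_insert_right)

lemma count_below_add_period:
  assumes "\<And>n. n + q \<in> P \<longleftrightarrow> n \<in> P"
  shows "count_below P (N + q) = count_below P N + count_below P q"
proof (induction N)
  case 0
  then show ?case by (simp add: count_below_def)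
next
  case (Suc N)
  then show ?case using assms[of N] by (simp add: count_below_Suc)
qed

text \<open>A periodic set is uniformly distributed up to an error of one period, because the
  deviation of its counting function from the linear one is itself periodic.\<close>

lemma periodic_count:
  assumes q: "q > 0" and per: "\<And>n. n + q \<in> P \<longleftrightarrow> n \<in> P"
    and \<rho>: "\<rho> = real (count_below P q) / real q" and uv: "u \<le> v"
  shows "\<bar>real (card (P \<inter> {u..<v})) - \<rho> * (real v - real u)\<bar> \<le> real q"
proof -
  define g where "g N = real (count_below P N) - \<rho> * real N" for N
  have g_add: "g (N + q) = g N" for N
    using q by (simp add: g_def \<rho> count_below_add_period[OF per] field_simps)
  have g_mult: "g (N + t * q) = g N" for N t
  proof (induction t)
    case (Suc t)
    then show ?case using g_add[of "N + t * q"] by (simp add: ac_simps)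
  qed simp
  have g_mod: "g N = g (N mod q)" for N
    using g_mult[of "N mod q" "N div q"] by simp
  have \<rho>01: "0 \<le> \<rho>" "\<rho> \<le> 1"
    using q count_below_le[of P q] by (auto simp: \<rho>)
  have less: "\<bar>g b - g a\<bar> \<le> real q" if "a \<le> b" "b < q" for a b
  proof -
    have "g b - g a = real (card (P \<inter> {a..<b})) - \<rho> * (real b - real a)"
      using count_below_diff[OF that(1), of P] by (simp add: g_def algebra_simps)
    moreover have "real (card (P \<inter> {a..<b})) \<le> real q"
      using card_Int_interval_le[of P a b] that by linarith
    moreover have "\<rho> * (real b - real a) \<le> 1 * real q"
      by (rule mult_mono) (use that \<rho>01 in auto)
    moreover have "0 \<le> \<rho> * (real b - real a)"
      using that \<rho>01 by simp
    ultimately show ?thesis by linarith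
  qed
  have "\<bar>g (v mod q) - g (u mod q)\<bar> \<le> real q"
    using less[of "u mod q" "v mod q"] less[of "v mod q" "u mod q"] q
    by (cases "u mod q \<le> v mod q") (auto simp: abs_minus_commute)
  then have "\<bar>g v - g u\<bar> \<le> real q" using g_mod by metis
  then show ?thesis
    using count_below_diff[OF uv, of P] by (simp add: g_def algebra_simps)
qed

section \<open>Sets defined by small residues\<close>

text \<open>The moduli form a divisibility chain with unbounded ratios, and \<open>cutoff k\<close> lies far
  between two consecutive moduli: it is \<open>2 ^ k\<close> times \<open>modulus k\<close>, and \<open>modulus (Suc k)\<close> is
  \<open>2 ^ (k + 1)\<close> times \<open>cutoff k\<close>.\<close>

definition modulus :: "nat \<Rightarrow> nat" where "modulus k = 2 ^ (k * k)"

definition cutoff :: "nat \<Rightarrow> nat" where "cutoff k = 2 ^ (k * k + k)"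

text \<open>The numbers whose residue modulo \<open>modulus i\<close> lies in the initial proportion \<open>\<theta>\<close> of all
  residues, for every \<open>i \<in> S\<close>. In the mixed radix system given by the moduli, this restricts
  essentially one leading digit for each \<open>i\<close>.\<close>

definition digit_set :: "real \<Rightarrow> nat set \<Rightarrow> nat set" where
  "digit_set \<theta> S = {n. \<forall>i\<in>S. real (n mod modulus i) < \<theta> * real (modulus i)}"

lemma modulus_pos: "modulus k > 0"
  and cutoff_pos: "cutoff k > 0"
  by (simp_all add: modulus_def cutoff_def)

lemma modulus_dvd: "i \<le> k \<Longrightarrow> modulus i dvd modulus k"
  by (auto simp: modulus_def intro!: le_imp_power_dvd mult_le_mono)

lemma modulus_mono: "i \<le> k \<Longrightarrow> modulus i \<le> modulus k"
  by (meson dvd_imp_le modulus_dvd modulus_pos)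

lemma modulus_Suc: "modulus (Suc k) = 2 * 4 ^ k * modulus k"
proof -
  have "Suc k * Suc k = Suc (2 * k + k * k)" by simp
  then have "modulus (Suc k) = 2 * ((2 ^ 2) ^ k * modulus k)"
    by (simp only: modulus_def power_Suc power_add power_mult)
  then show ?thesis by simp
qed

lemma cutoff_eq: "cutoff k = 2 ^ k * modulus k"
  by (simp add: cutoff_def modulus_def power_add)

lemma cutoff_Suc: "cutoff (Suc k) = 4 * 4 ^ k * cutoff k"
  by (simp add: cutoff_eq modulus_Suc)

lemma modulus_Suc_cutoff: "modulus (Suc k) = 2 * 2 ^ k * cutoff k"
proof -
  have "(4::nat) ^ k = 2 ^ k * 2 ^ k" by (simp flip: power_mult_distrib)
  then show ?thesis by (simp add: cutoff_eq modulus_Suc)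
qed

lemma strict_mono_cutoff: "strict_mono cutoff"
  unfolding strict_mono_Suc_iff
proof
  fix k
  have "1 * cutoff k < 4 * 4 ^ k * cutoff k"
    by (rule mult_strict_right_mono) (simp_all add: cutoff_pos Suc_lessI)
  then show "cutoff k < cutoff (Suc k)" by (simp add: cutoff_Suc)
qed

lemma digit_set_periodic:
  assumes "S \<subseteq> {..b}"
  shows "n + modulus b \<in> digit_set \<theta> S \<longleftrightarrow> n \<in> digit_set \<theta> S"
proof -
  have "(n + modulus b) mod modulus i = n mod modulus i" if "i \<in> S" for i
  proof -
    have "i \<le> b" using that assms by auto
    then obtain t where "modulus b = modulus i * t"
      by (blast dest: modulus_dvd elim: dvdE)
    then show ?thesis by simp
  qed
  then show ?thesis by (simp add: digit_set_def)
qed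

text \<open>The conditions at different indices \<open>\<ge> a\<close> are independent up to an error of order
  \<open>(1/2) ^ a\<close> in the density. The induction is on the largest index: the set given by the smaller
  indices has period \<open>modulus b\<close>, which is short compared with the initial segment of
  \<open>[0, modulus (Suc b))\<close> that the additional condition cuts out.\<close>

lemma digit_set_count:
  fixes \<theta> :: real
  assumes \<theta>: "0 < \<theta>" "\<theta> \<le> 1" and a: "a \<ge> 1"
  shows "S \<subseteq> {a..b} \<Longrightarrow> u \<le> v \<Longrightarrow>
    \<bar>real (card (digit_set \<theta> S \<inter> {u..<v})) - \<theta> ^ card S * (real v - real u)\<bar>
      \<le> 4 * real (card S) * (1/2) ^ a * (real v - real u) + real (modulus b)"
proof (induction b arbitrary: S u v)
  case 0
  then have "S = {}" using a by auto
  then show ?case using 0 by (simp add: digit_set_def)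
next
  case (Suc b)
  show ?case
  proof (cases "Suc b \<in> S")
    case False
    then have "S \<subseteq> {a..b}" using Suc.prems(1) le_Suc_eq by auto
    from Suc.IH[OF this Suc.prems(2)] show ?thesis
      using modulus_mono[of b "Suc b"] by simp
  next
    case True
    define S' where "S' = S - {Suc b}"
    define s where "s = card S'"
    define M where "M = modulus (Suc b)"
    define L where "L = nat \<lceil>\<theta> * real M\<rceil>"
    have ab: "a \<le> Suc b" using True Suc.prems(1) by auto
    have S': "S' \<subseteq> {a..b}" using Suc.prems(1) le_Suc_eq by (auto simp: S'_def)
    have "finite S" using Suc.prems(1) finite_subset by blast
    then have cS: "card S = Suc s"
      using True unfolding s_def S'_def by (rule card.remove)
    have M: "M > 0" by (simp add: M_def modulus_pos)
    have L: "\<theta> * real M \<le> real L" "real L \<le> \<theta> * real M + 1" "L \<le> M"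
    proof -
      show "\<theta> * real M \<le> real L" by (simp add: L_def of_nat_ceiling)
      have "0 \<le> \<theta> * real M" using \<theta> by simp
      then show "real L \<le> \<theta> * real M + 1" unfolding L_def by linarith
      have "\<theta> * real M \<le> real M" using \<theta> mult_right_mono[of \<theta> 1 "real M"] by simp
      then show "L \<le> M" by (simp add: L_def ceiling_le_iff)
    qed
    have less_L: "real n < \<theta> * real M \<longleftrightarrow> n < L" for n
      by (simp add: L_def less_ceiling_iff zless_nat_eq_int_zless)
    \<comment> \<open>One period of the larger set is an initial segment of the smaller one.\<close>
    have eq: "digit_set \<theta> S \<inter> {0..<M} = digit_set \<theta> S' \<inter> {0..<L}"
    proof -
      have "n \<in> digit_set \<theta> S \<longleftrightarrow> n \<in> digit_set \<theta> S' \<and> real (n mod M) < \<theta> * real M" for n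
        using True by (auto simp: digit_set_def S'_def M_def)
      then show ?thesis using L(3) less_L by auto
    qed
    define c where "c = real (count_below (digit_set \<theta> S) M)"
    have "\<bar>c - \<theta> ^ s * real L\<bar> \<le> 4 * real s * (1/2) ^ a * real L + real (modulus b)"
      using Suc.IH[OF S', of 0 L] by (simp add: c_def count_below_def eq s_def)
    moreover have "4 * real s * (1/2) ^ a * real L \<le> 4 * real s * (1/2) ^ a * real M"
      using L(3) by (intro mult_left_mono) auto
    moreover have "\<bar>\<theta> ^ s * real L - \<theta> ^ Suc s * real M\<bar> \<le> 1"
    proof -
      have "\<bar>\<theta> ^ s * real L - \<theta> ^ Suc s * real M\<bar> = \<theta> ^ s * (real L - \<theta> * real M)"
        using L(1) \<theta> by (simp add: algebra_simps mult_le_cancel_left)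
      also have "\<dots> \<le> 1 * 1"
        using L \<theta> by (intro mult_mono power_le_one) auto
      finally show ?thesis by simp
    qed
    moreover have "real (modulus b) + 1 \<le> 4 * (1/2) ^ a * real M"
    proof -
      have "(1::real) \<le> 2 * 2 ^ b * (1/2) ^ a"
        using power_decreasing[OF ab, of "1/2::real"] by (simp add: field_simps)
      also have "\<dots> \<le> 2 * 4 ^ b * (1/2) ^ a"
        by (simp add: power_mono)
      finally have "2 * real (modulus b) * 1 \<le> 2 * real (modulus b) * (2 * 4 ^ b * (1/2) ^ a)"
        by (rule mult_left_mono) simp
      moreover have "4 * (1/2) ^ a * real M = 2 * (2 * real (modulus b) * (2 * 4 ^ b * (1/2) ^ a))"
        by (simp add: M_def modulus_Suc)
      moreover have "real (modulus b) \<ge> 1" using modulus_pos[of b] by simp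
      ultimately show ?thesis by linarith
    qed
    ultimately have "\<bar>c - \<theta> ^ Suc s * real M\<bar> \<le> 4 * real (Suc s) * (1/2) ^ a * real M"
      by (simp add: algebra_simps)
    moreover have "c / real M - \<theta> ^ Suc s = (c - \<theta> ^ Suc s * real M) / real M"
      using M by (simp add: field_simps)
    ultimately have \<rho>: "\<bar>c / real M - \<theta> ^ Suc s\<bar> \<le> 4 * real (Suc s) * (1/2) ^ a"
      using M by (simp add: pos_divide_le_eq)
    have "\<bar>real (card (digit_set \<theta> S \<inter> {u..<v})) - c / real M * (real v - real u)\<bar> \<le> real M"
    proof (rule periodic_count[OF M _ _ Suc.prems(2)])
      show "n + M \<in> digit_set \<theta> S \<longleftrightarrow> n \<in> digit_set \<theta> S" for n
        unfolding M_def by (rule digit_set_periodic) (use Suc.prems(1) in auto)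
    qed (simp add: c_def)
    moreover have "\<bar>c / real M * (real v - real u) - \<theta> ^ Suc s * (real v - real u)\<bar>
        \<le> 4 * real (Suc s) * (1/2) ^ a * (real v - real u)"
    proof -
      have "c / real M * (real v - real u) - \<theta> ^ Suc s * (real v - real u)
          = (c / real M - \<theta> ^ Suc s) * (real v - real u)"
        by (simp only: left_diff_distrib)
      then show ?thesis
        using mult_right_mono[OF \<rho>, of "real v - real u"] Suc.prems(2) by (simp only: abs_mult) simp
    qed
    ultimately show ?thesis unfolding cS M_def by linarith
  qed
qed

section \<open>The set\<close>

text \<open>The \<open>r\<close> indices up to \<open>k\<close>; by truncated subtraction there are fewer of them only if
  \<open>k + 1 < r\<close>.\<close>

definition window :: "nat \<Rightarrow> nat \<Rightarrow> nat set" where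
  "window r k = {Suc k - r..k}"

text \<open>In stage \<open>k\<close>, meaning \<open>[cutoff k, cutoff (Suc k))\<close>, residues are restricted at the indices
  of the window of \<open>k\<close>, which slides by one at each stage; the second set consists of the short
  intervals added at the beginning of the stages \<open>k\<close> that are multiples of \<open>r + 2\<close>.\<close>

definition sliding_set :: "real \<Rightarrow> nat \<Rightarrow> nat set" where
  "sliding_set \<delta> r =
     {n. \<exists>k. cutoff k \<le> n \<and> n < cutoff (Suc k) \<and> n \<in> digit_set \<delta> (window r k)} \<union>
     {n. \<exists>k. (r + 2) dvd k \<and> cutoff k \<le> n \<and> n < cutoff k + modulus k}"

lemma card_window: "r \<le> k \<Longrightarrow> card (window r k) = r"
  by (simp add: window_def)

lemma cutoff_less_iff: "cutoff i < cutoff j \<longleftrightarrow> i < j"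
  using strict_mono_cutoff by (rule strict_mono_less)

lemma cutoff_le_iff: "cutoff i \<le> cutoff j \<longleftrightarrow> i \<le> j"
  using strict_mono_cutoff by (rule strict_mono_less_eq)

lemma modulus_le_cutoff: "2 ^ k * modulus k = cutoff k" "modulus k \<le> cutoff k"
  by (simp_all add: cutoff_eq)

lemma cutoff_Suc_ge: "2 ^ k * cutoff k \<le> cutoff (Suc k)" "2 * cutoff k \<le> cutoff (Suc k)"
proof -
  have "(2::nat) ^ k \<le> 4 ^ k" by (simp add: power_mono)
  then have "(2::nat) ^ k \<le> 4 * 4 ^ k" by linarith
  then show "2 ^ k * cutoff k \<le> cutoff (Suc k)"
    unfolding cutoff_Suc by (rule mult_right_mono) simp
  have "(1::nat) \<le> 4 ^ k" by simp
  then have "(2::nat) \<le> 4 * 4 ^ k" by linarith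
  then show "2 * cutoff k \<le> cutoff (Suc k)"
    unfolding cutoff_Suc by (rule mult_right_mono) simp
qed

lemma stage_exists:
  assumes "n \<ge> 1"
  obtains k where "cutoff k \<le> n" "n < cutoff (Suc k)"
proof -
  have "n < cutoff (Suc n)"
    using strict_mono_imp_increasing[OF strict_mono_cutoff, of "Suc n"] by linarith
  moreover have "\<not> n < cutoff 0" using assms by (simp add: cutoff_def)
  ultimately obtain k where "\<forall>i\<le>k. \<not> n < cutoff i" "n < cutoff (Suc k)"
    using ex_least_nat_less[of "\<lambda>k. n < cutoff k" "Suc n"] by blast
  then show ?thesis using that[of k] by force
qed

lemma stage_unique:
  assumes "cutoff j \<le> n" "n < cutoff (Suc j)" "cutoff k \<le> n" "n < cutoff (Suc k)"
  shows "j = k"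
proof -
  have "cutoff j < cutoff (Suc k)" "cutoff k < cutoff (Suc j)" using assms by linarith+
  then show ?thesis by (simp add: cutoff_less_iff)
qed

lemma interval_in_stage:
  assumes "n < cutoff k + modulus k"
  shows "n < cutoff (Suc k)"
  using assms modulus_le_cutoff(2)[of k] cutoff_Suc_ge(2)[of k] by linarith

lemma sliding_set_iff:
  assumes "cutoff k \<le> n" "n < cutoff (Suc k)"
  shows "n \<in> sliding_set \<delta> r \<longleftrightarrow>
    n \<in> digit_set \<delta> (window r k) \<or> (r + 2) dvd k \<and> n < cutoff k + modulus k"
proof
  assume "n \<in> sliding_set \<delta> r"
  then consider
      j where "cutoff j \<le> n" "n < cutoff (Suc j)" "n \<in> digit_set \<delta> (window r j)"
    | j where "(r + 2) dvd j" "cutoff j \<le> n" "n < cutoff j + modulus j"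
    unfolding sliding_set_def by blast
  then show "n \<in> digit_set \<delta> (window r k) \<or> (r + 2) dvd k \<and> n < cutoff k + modulus k"
  proof cases
    case 1
    then show ?thesis using stage_unique[OF 1(1,2) assms] by simp
  next
    case 2
    then show ?thesis using stage_unique[OF 2(2) interval_in_stage[OF 2(3)] assms] by simp
  qed
qed (use assms in \<open>auto simp: sliding_set_def\<close>)

section \<open>Its density\<close>

lemma le_half_power_mult:
  assumes "2 ^ k * a \<le> N"
  shows "real a \<le> (1/2) ^ k * real N"
proof -
  have "real (2 ^ k * a) \<le> real N" using assms by (rule of_nat_mono)
  then show ?thesis by (simp add: power_divide field_simps)
qed

lemma cutoff_le_half_power:
  assumes "cutoff (Suc k) \<le> N"
  shows "real (cutoff k) \<le> (1/2) ^ k * real N"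
  by (rule le_half_power_mult) (use cutoff_Suc_ge(1)[of k] assms in linarith)

lemma sliding_set_stage_count:
  assumes \<delta>: "0 < \<delta>" "\<delta> \<le> 1" and r: "r \<le> k" and N: "cutoff k \<le> N" "N \<le> cutoff (Suc k)"
  shows "\<bar>real (card (sliding_set \<delta> r \<inter> {cutoff k..<N})) - \<delta> ^ r * (real N - real (cutoff k))\<bar>
    \<le> 4 * real r * (1/2) ^ (Suc k - r) * real N + 2 * real (modulus k)"
proof -
  define H where "H = digit_set \<delta> (window r k)"
  define I where "I = {cutoff k..<N}"
  have mem: "n \<in> sliding_set \<delta> r \<longleftrightarrow> n \<in> H \<or> (r + 2) dvd k \<and> n < cutoff k + modulus k"
    if "n \<in> I" for n
    using sliding_set_iff[of k n] that N by (simp add: I_def H_def)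
  have "card (sliding_set \<delta> r \<inter> I) \<le> card ((H \<inter> I) \<union> {cutoff k..<cutoff k + modulus k})"
    by (rule card_mono) (use mem in \<open>auto simp: I_def\<close>)
  also have "\<dots> \<le> card (H \<inter> I) + modulus k"
    using card_Un_le[of "H \<inter> I" "{cutoff k..<cutoff k + modulus k}"] by simp
  finally have "card (sliding_set \<delta> r \<inter> I) \<le> card (H \<inter> I) + modulus k" .
  moreover have "card (H \<inter> I) \<le> card (sliding_set \<delta> r \<inter> I)"
    by (rule card_mono) (use mem in \<open>auto simp: I_def\<close>)
  moreover have "\<bar>real (card (H \<inter> I)) - \<delta> ^ r * (real N - real (cutoff k))\<bar>
      \<le> 4 * real r * (1/2) ^ (Suc k - r) * (real N - real (cutoff k)) + real (modulus k)"
    using digit_set_count[OF \<delta>, of "Suc k - r" "window r k" k "cutoff k" N] r N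
    by (simp add: H_def I_def card_window) (simp add: window_def)
  moreover have "4 * real r * (1/2) ^ (Suc k - r) * (real N - real (cutoff k))
      \<le> 4 * real r * (1/2) ^ (Suc k - r) * real N"
    by (intro mult_left_mono) auto
  ultimately show ?thesis unfolding I_def by linarith
qed

lemma half_power_diff:
  assumes "r \<le> k"
  shows "(1/2::real) ^ (Suc k - r) \<le> 2 ^ r * (1/2) ^ k"
proof -
  have "(1/2::real) ^ (Suc k - r) \<le> (1/2) ^ (k - r)"
    by (rule power_decreasing) auto
  also have "\<dots> = 2 ^ r * (1/2) ^ k"
    using assms by (simp add: power_diff power_divide)
  finally show ?thesis .
qed

text \<open>At \<open>N\<close> in stage \<open>k + 1\<close>, the stages \<open>k\<close> and \<open>k + 1\<close> are counted accurately, and all earlier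
  ones trivially, as they reach only up to \<open>cutoff k \<le> (1/2) ^ k * N\<close>.\<close>

lemma sliding_set_count:
  assumes \<delta>: "0 < \<delta>" "\<delta> \<le> 1" and r: "r \<le> k"
    and N: "cutoff (Suc k) \<le> N" "N \<le> cutoff (Suc (Suc k))"
  shows "\<bar>real (count_below (sliding_set \<delta> r) N) - \<delta> ^ r * real N\<bar>
    \<le> (5 + 8 * real r * 2 ^ r) * (1/2) ^ k * real N"
proof -
  define A where "A = sliding_set \<delta> r"
  define E where "E = 4 * real r * (2 ^ r * (1/2) ^ k) * real N"
  have le: "cutoff k \<le> cutoff (Suc k)" by (simp add: cutoff_le_iff)
  have "real (count_below A N) = real (count_below A (cutoff k))
      + real (card (A \<inter> {cutoff k..<cutoff (Suc k)})) + real (card (A \<inter> {cutoff (Suc k)..<N}))"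
    using count_below_diff[OF le, of A] count_below_diff[OF N(1), of A] by linarith
  moreover have "\<bar>real (card (A \<inter> {cutoff k..<cutoff (Suc k)}))
      - \<delta> ^ r * (real (cutoff (Suc k)) - real (cutoff k))\<bar> \<le> E + 2 * real (modulus k)"
  proof -
    have "4 * real r * (1/2) ^ (Suc k - r) * real (cutoff (Suc k)) \<le> E"
      unfolding E_def using half_power_diff[OF r] N by (intro mult_mono) auto
    then show ?thesis
      using sliding_set_stage_count[OF \<delta> r le] by (simp add: A_def)
  qed
  moreover have "\<bar>real (card (A \<inter> {cutoff (Suc k)..<N}))
      - \<delta> ^ r * (real N - real (cutoff (Suc k)))\<bar> \<le> E + 2 * real (modulus (Suc k))"
  proof -
    have "(1/2::real) ^ (Suc (Suc k) - r) \<le> (1/2) ^ (Suc k - r)"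
      by (rule power_decreasing) auto
    also have "\<dots> \<le> 2 ^ r * (1/2) ^ k" by (rule half_power_diff[OF r])
    finally have "4 * real r * (1/2) ^ (Suc (Suc k) - r) * real N \<le> E"
      unfolding E_def by (intro mult_mono) auto
    then show ?thesis
      using sliding_set_stage_count[OF \<delta> _ N, of r] r by (simp add: A_def)
  qed
  moreover have "\<bar>real (count_below A (cutoff k)) - \<delta> ^ r * real (cutoff k)\<bar> \<le> real (cutoff k)"
  proof -
    have "\<delta> ^ r * real (cutoff k) \<le> 1 * real (cutoff k)"
      using \<delta> by (intro mult_right_mono power_le_one) auto
    moreover have "0 \<le> \<delta> ^ r * real (cutoff k)" using \<delta> by simp
    moreover have "real (count_below A (cutoff k)) \<le> real (cutoff k)"
      using count_below_le by simp
    ultimately show ?thesis by linarith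
  qed
  moreover have "real (cutoff k) \<le> (1/2) ^ k * real N"
    using N by (intro cutoff_le_half_power)
  moreover have "real (modulus (Suc k)) \<le> (1/2) ^ k * real N"
    by (rule le_half_power_mult) (use modulus_le_cutoff(1)[of "Suc k"] N in simp)
  moreover have "real (modulus k) \<le> real (modulus (Suc k))"
    by (simp add: modulus_mono)
  moreover have "(5 + 8 * real r * 2 ^ r) * (1/2) ^ k * real N = 2 * E + 5 * ((1/2) ^ k * real N)"
    by (simp add: E_def algebra_simps)
  moreover have "\<delta> ^ r * real N = \<delta> ^ r * real (cutoff k)
      + \<delta> ^ r * (real (cutoff (Suc k)) - real (cutoff k)) + \<delta> ^ r * (real N - real (cutoff (Suc k)))"
    by (simp add: algebra_simps)
  ultimately show ?thesis unfolding A_def by linarith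
qed

lemma tendsto_const_half_power: "(\<lambda>k. c * (1/2) ^ k) \<longlonglongrightarrow> (0::real)"
  by (intro tendsto_mult_right_zero LIMSEQ_power_zero) simp

lemma sliding_set_density:
  assumes \<delta>: "0 < \<delta>" "\<delta> \<le> 1"
  shows "(\<lambda>N. real (count_below (sliding_set \<delta> r) N) / real N) \<longlonglongrightarrow> \<delta> ^ r"
proof (rule LIMSEQ_I)
  fix \<epsilon> :: real assume "\<epsilon> > 0"
  define C where "C = 5 + 8 * real r * 2 ^ r"
  have "eventually (\<lambda>k. C * (1/2) ^ k < \<epsilon>) sequentially"
    using order_tendstoD(2)[OF tendsto_const_half_power \<open>\<epsilon> > 0\<close>] .
  then obtain K where K: "\<And>k. k \<ge> K \<Longrightarrow> C * (1/2) ^ k < \<epsilon>"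
    unfolding eventually_sequentially by blast
  have "norm (real (count_below (sliding_set \<delta> r) N) / real N - \<delta> ^ r) < \<epsilon>"
    if N: "N \<ge> cutoff (Suc (max K r))" for N
  proof -
    have "N > 0" using N cutoff_pos[of "Suc (max K r)"] by linarith
    then obtain j where j: "cutoff j \<le> N" "N < cutoff (Suc j)"
      using stage_exists[of N] by auto
    then have "cutoff (Suc (max K r)) < cutoff (Suc j)" using N by linarith
    then have "max K r < j" by (simp add: cutoff_less_iff)
    then obtain k where k: "j = Suc k" "K \<le> k" "r \<le> k" by (cases j) auto
    have "\<bar>real (count_below (sliding_set \<delta> r) N) - \<delta> ^ r * real N\<bar> \<le> C * (1/2) ^ k * real N"
      using sliding_set_count[OF \<delta> k(3), of N] j k by (simp add: C_def)
    also have "\<dots> < \<epsilon> * real N"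
      using K[OF k(2)] \<open>N > 0\<close> by (intro mult_strict_right_mono) auto
    finally have "\<bar>real (count_below (sliding_set \<delta> r) N) - \<delta> ^ r * real N\<bar> / real N < \<epsilon>"
      using \<open>N > 0\<close> by (simp add: pos_divide_less_eq)
    moreover have "real (count_below (sliding_set \<delta> r) N) / real N - \<delta> ^ r
        = (real (count_below (sliding_set \<delta> r) N) - \<delta> ^ r * real N) / real N"
      using \<open>N > 0\<close> by (simp add: field_simps)
    ultimately show ?thesis by simp
  qed
  then show "\<exists>no. \<forall>n\<ge>no. norm (real (count_below (sliding_set \<delta> r) n) / real n - \<delta> ^ r) < \<epsilon>"
    by blast
qed

section \<open>Its sumset\<close>

lemma sumset_contains_stage:
  assumes \<delta>: "0 < \<delta>" and k: "(r + 2) dvd k" and z: "2 * cutoff k \<le> z" "z < cutoff (Suc k)"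
  shows "z \<in> sliding_set \<delta> r + sliding_set \<delta> r"
proof -
  \<comment> \<open>The summand \<open>y\<close> is the largest multiple of \<open>modulus k\<close> with \<open>z - y \<ge> cutoff k\<close>.\<close>
  define s where "s = (z - cutoff k) mod modulus k"
  define y where "y = z - cutoff k - s"
  define x where "x = cutoff k + s"
  have s: "s < modulus k" by (simp add: s_def modulus_pos)
  have s_le: "s \<le> z - cutoff k" by (simp add: s_def)
  have z_eq: "z = x + y" using z s_le by (simp add: x_def y_def)
  have y_dvd: "modulus k dvd y" unfolding y_def s_def by (rule dvd_minus_mod)
  have "cutoff k \<le> y"
  proof -
    have "modulus k dvd cutoff k" by (simp add: cutoff_eq)
    then have "cutoff k div modulus k * modulus k = cutoff k" by simp
    moreover have "cutoff k div modulus k \<le> (z - cutoff k) div modulus k"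
      using z by (intro div_le_mono) simp
    ultimately have "cutoff k \<le> (z - cutoff k) div modulus k * modulus k"
      by (metis mult_le_mono1)
    then show ?thesis by (simp add: y_def s_def minus_mod_eq_div_mult)
  qed
  moreover have "y < cutoff (Suc k)" using z by (simp add: y_def)
  moreover have "y \<in> digit_set \<delta> (window r k)"
  proof -
    have "real (y mod modulus i) < \<delta> * real (modulus i)" if "i \<in> window r k" for i
    proof -
      have "modulus i dvd y"
        using modulus_dvd[of i k] that y_dvd by (auto simp: window_def intro: dvd_trans)
      then show ?thesis using \<delta> modulus_pos[of i] by simp
    qed
    then show ?thesis by (simp add: digit_set_def)
  qed
  ultimately have "y \<in> sliding_set \<delta> r" by (auto simp: sliding_set_def)
  moreover have "x \<in> sliding_set \<delta> r"
    using k s by (auto simp: sliding_set_def x_def)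
  ultimately show ?thesis unfolding z_eq by blast
qed

lemma small_in_digit_set:
  assumes "x < cutoff (Suc j)" "j + 2 \<le> i" "1 \<le> \<delta> * 2 ^ i"
  shows "real (x mod modulus i) < \<delta> * real (modulus i)"
proof -
  obtain l where l: "i = Suc l" "Suc j \<le> l" using assms(2) by (cases i) auto
  have "x < cutoff l" using assms(1) l(2) cutoff_le_iff[of "Suc j" l] by linarith
  then have "real (x mod modulus i) < real (cutoff l)"
    using mod_less_eq_dividend[of x "modulus i"] by linarith
  also have "\<dots> \<le> (\<delta> * 2 ^ i) * real (cutoff l)"
    using mult_right_mono[OF assms(3), of "real (cutoff l)"] by simp
  also have "\<dots> = \<delta> * real (modulus i)"
    by (simp add: l modulus_Suc_cutoff)
  finally show ?thesis .
qed

text \<open>The hypothesis \<open>1 \<le> \<delta> * 2 ^ (Suc k - r)\<close> ensures that \<open>k\<close> is large enough for numbers of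
  stages \<open>j \<le> i - 2\<close> to be small at each index \<open>i\<close> of the window of \<open>k\<close>.\<close>

lemma sumset_subset:
  assumes r: "1 \<le> r" "r \<le> k" and k: "(r + 2) dvd Suc k" and \<delta>0: "0 < \<delta>"
    and \<delta>: "1 \<le> \<delta> * 2 ^ (Suc k - r)"
    and z: "z \<in> sliding_set \<delta> r + sliding_set \<delta> r" "2 * cutoff k \<le> z" "z < cutoff (Suc k)"
  shows "\<exists>m\<in>window r k. z \<in> digit_set (2 * \<delta>) (window r k - {m})"
proof -
  have "\<exists>x y. z = x + y \<and> x \<le> y \<and> x \<in> sliding_set \<delta> r \<and> y \<in> sliding_set \<delta> r"
  proof -
    obtain a b where "z = a + b" "a \<in> sliding_set \<delta> r" "b \<in> sliding_set \<delta> r"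
      using z(1) by (auto elim: set_plus_elim)
    then show ?thesis by (metis add.commute linear)
  qed
  then obtain x y where xy: "z = x + y" "x \<le> y"
    and x: "x \<in> sliding_set \<delta> r" and y: "y \<in> sliding_set \<delta> r" by blast
  have "\<not> (r + 2) dvd k"
  proof
    assume "(r + 2) dvd k"
    then have "(r + 2) dvd Suc k - k" using k by (intro dvd_diff_nat)
    then show False by simp
  qed
  then have y': "y \<in> digit_set \<delta> (window r k)"
    using sliding_set_iff[of k y] y xy z by auto
  obtain j where j: "cutoff j \<le> x" "x < cutoff (Suc j)"
    and xj: "x \<in> digit_set \<delta> (window r j) \<or> (r + 2) dvd j"
  proof -
    have "0 \<notin> sliding_set \<delta> r" using cutoff_pos by (simp add: sliding_set_def)
    then have "x \<ge> 1" using x by (cases x) auto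
    then obtain j where j: "cutoff j \<le> x" "x < cutoff (Suc j)" by (rule stage_exists)
    then show ?thesis using that[of j] sliding_set_iff[OF j] x by blast
  qed
  have "cutoff j < cutoff (Suc k)" using j xy z by linarith
  then have jk: "j \<le> k" by (simp add: cutoff_less_iff)
  have x_digit: "real (x mod modulus i) < \<delta> * real (modulus i)"
    if i: "i \<in> window r k" "i \<noteq> Suc j" for i
  proof (cases "j + 2 \<le> i")
    case True
    have "Suc k - r \<le> i" using i by (simp add: window_def)
    then have "\<delta> * 2 ^ (Suc k - r) \<le> \<delta> * 2 ^ i"
      using \<delta>0 by (intro mult_left_mono power_increasing) auto
    then have "1 \<le> \<delta> * 2 ^ i" using \<delta> by linarith
    then show ?thesis by (rule small_in_digit_set[OF j(2) True])
  next
    case False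
    then have "i \<le> j" using i by simp
    \<comment> \<open>Two multiples of \<open>r + 2\<close> differ by at least \<open>r + 2\<close>, so an interval added in stage \<open>j\<close>
      would have \<open>j\<close> below the window of \<open>k\<close>.\<close>
    have "\<not> (r + 2) dvd j"
    proof
      assume "(r + 2) dvd j"
      then have "(r + 2) dvd Suc k - j" using k by (intro dvd_diff_nat)
      then have "r + 2 \<le> Suc k - j" using jk by (intro dvd_imp_le) auto
      moreover have "Suc k - r \<le> i" using i by (simp add: window_def)
      ultimately show False using \<open>i \<le> j\<close> by linarith
    qed
    then have "x \<in> digit_set \<delta> (window r j)" using xj by blast
    moreover have "i \<in> window r j" using i \<open>i \<le> j\<close> jk by (simp add: window_def)
    ultimately show ?thesis by (simp add: digit_set_def)
  qed
  \<comment> \<open>If \<open>Suc j\<close> is not in the window, no condition is lost and any \<open>m\<close> will do.\<close>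
  define m where "m = (if Suc j \<in> window r k then Suc j else k)"
  have "k \<in> window r k" using r by (simp add: window_def)
  then have "m \<in> window r k" by (simp add: m_def)
  moreover have "z \<in> digit_set (2 * \<delta>) (window r k - {m})"
  proof -
    have "real (z mod modulus i) < 2 * \<delta> * real (modulus i)"
      if i: "i \<in> window r k" "i \<noteq> m" for i
    proof -
      have "i \<noteq> Suc j" using i by (auto simp: m_def)
      then have "real (x mod modulus i) < \<delta> * real (modulus i)" using x_digit i by blast
      moreover have "real (y mod modulus i) < \<delta> * real (modulus i)"
        using y' i by (simp add: digit_set_def)
      moreover have "z mod modulus i \<le> x mod modulus i + y mod modulus i"
        unfolding xy(1) by (metis mod_add_eq mod_less_eq_dividend)
      ultimately show ?thesis by linarith
    qed
    then show ?thesis by (simp add: digit_set_def)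
  qed
  ultimately show ?thesis by blast
qed

lemma sumset_count_le:
  assumes \<delta>: "0 < \<delta>" "\<delta> \<le> 1/2" "1 \<le> \<delta> * 2 ^ (Suc k - r)"
    and r: "1 \<le> r" "r \<le> k" and k: "(r + 2) dvd Suc k"
  defines "N \<equiv> cutoff (Suc k)"
  shows "real (count_below (sliding_set \<delta> r + sliding_set \<delta> r) N) / real N
    \<le> real r * (2 * \<delta>) ^ (r - 1) + (2 + real r * (4 * real r * 2 ^ r + 1)) * (1/2) ^ k"
proof -
  define W where "W = window r k"
  define D where "D m = digit_set (2 * \<delta>) (W - {m}) \<inter> {0..<N}" for m
  define B where "B = (2 * \<delta>) ^ (r - 1) * real N + 4 * real r * (2 ^ r * (1/2) ^ k) * real N
    + (1/2) ^ k * real N"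
  have N: "N > 0" by (simp add: N_def cutoff_pos)
  have finW: "finite W" and cW: "card W = r"
    using r by (simp_all add: W_def card_window) (simp add: window_def)
  have cutoff_le: "real (cutoff k) \<le> (1/2) ^ k * real N"
    by (rule cutoff_le_half_power) (simp add: N_def)
  have D_le: "real (card (D m)) \<le> B" if m: "m \<in> W" for m
  proof -
    have c: "card (W - {m}) = r - 1" using m finW cW by simp
    have "\<bar>real (card (D m)) - (2 * \<delta>) ^ (r - 1) * real N\<bar>
        \<le> 4 * real (r - 1) * (1/2) ^ (Suc k - r) * real N + real (modulus k)"
      using digit_set_count[of "2 * \<delta>" "Suc k - r" "W - {m}" k 0 N] \<delta> r
      unfolding D_def c by (simp add: W_def window_def subset_iff)
    moreover have "4 * real (r - 1) * (1/2) ^ (Suc k - r) * real N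
        \<le> 4 * real r * (2 ^ r * (1/2) ^ k) * real N"
      using half_power_diff[OF r(2)] by (intro mult_mono) auto
    moreover have "real (modulus k) \<le> real (cutoff k)"
      using modulus_le_cutoff(2) by simp
    ultimately show ?thesis using cutoff_le unfolding B_def by linarith
  qed
  let ?S = "sliding_set \<delta> r + sliding_set \<delta> r"
  have "?S \<inter> {0..<N} \<subseteq> {0..<2 * cutoff k} \<union> (\<Union>m\<in>W. D m)"
  proof
    fix z assume "z \<in> ?S \<inter> {0..<N}"
    then show "z \<in> {0..<2 * cutoff k} \<union> (\<Union>m\<in>W. D m)"
      using sumset_subset[OF r k \<delta>(1,3), of z] by (cases "z < 2 * cutoff k") (auto simp: N_def D_def W_def)
  qed
  moreover have "finite (\<Union>m\<in>W. D m)" using finW by (simp add: D_def)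
  ultimately have "card (?S \<inter> {0..<N}) \<le> card ({0..<2 * cutoff k} \<union> (\<Union>m\<in>W. D m))"
    by (intro card_mono) auto
  also have "\<dots> \<le> 2 * cutoff k + card (\<Union>m\<in>W. D m)"
    using card_Un_le[of "{0..<2 * cutoff k}" "\<Union>m\<in>W. D m"] by simp
  also have "\<dots> \<le> 2 * cutoff k + (\<Sum>m\<in>W. card (D m))"
    using card_UN_le[OF finW, of D] by simp
  finally have "real (count_below ?S N) \<le> real (2 * cutoff k + (\<Sum>m\<in>W. card (D m)))"
    unfolding count_below_def of_nat_le_iff .
  also have "\<dots> = 2 * real (cutoff k) + (\<Sum>m\<in>W. real (card (D m)))" by simp
  also have "\<dots> \<le> 2 * ((1/2) ^ k * real N) + real r * B"
    using sum_mono[of W "\<lambda>m. real (card (D m))" "\<lambda>_. B"] D_le cutoff_le cW by simp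
  also have "\<dots> = (real r * (2 * \<delta>) ^ (r - 1)
      + (2 + real r * (4 * real r * 2 ^ r + 1)) * (1/2) ^ k) * real N"
    by (simp add: B_def algebra_simps)
  finally show ?thesis using N by (simp add: pos_divide_le_eq)
qed

section \<open>The densities of the sumset\<close>

lemma lower_density_le_subseq:
  assumes s: "strict_mono s"
    and le: "eventually (\<lambda>m. real (count_below S (s m)) / real (s m) \<le> f m) sequentially"
    and f: "f \<longlonglongrightarrow> c"
  shows "lower_density S \<le> ereal c"
proof -
  define X where "X = (\<lambda>N. ereal (real (count_below S N) / real N))"
  have "lower_density S = liminf X"
    by (simp add: lower_density_def X_def count_below_def)
  also have "\<dots> \<le> liminf (X \<circ> s)" by (rule liminf_subseq_mono[OF s])
  also have "\<dots> \<le> liminf (\<lambda>m. ereal (f m))"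
    by (rule Liminf_mono, rule eventually_mono[OF le]) (simp add: X_def)
  also have "\<dots> = ereal c"
    using f by (intro lim_imp_Liminf) simp_all
  finally show ?thesis .
qed

lemma upper_density_ge_subseq:
  assumes s: "strict_mono s"
    and ge: "eventually (\<lambda>m. real (count_below S (s m)) / real (s m) \<ge> f m) sequentially"
    and f: "f \<longlonglongrightarrow> c"
  shows "ereal c \<le> upper_density S"
proof -
  define X where "X = (\<lambda>N. ereal (real (count_below S N) / real N))"
  have "ereal c = limsup (\<lambda>m. ereal (f m))"
    using f by (intro lim_imp_Limsup[symmetric]) simp_all
  also have "\<dots> \<le> limsup (X \<circ> s)"
    by (rule Limsup_mono, rule eventually_mono[OF ge]) (simp add: X_def)
  also have "\<dots> \<le> limsup X" by (rule limsup_subseq_mono[OF s])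
  also have "\<dots> = upper_density S"
    by (simp add: upper_density_def X_def count_below_def)
  finally show ?thesis .
qed

lemma upper_density_le_1: "upper_density S \<le> 1"
  unfolding upper_density_def
proof (rule Limsup_bounded, rule always_eventually, rule allI)
  fix N
  show "ereal (real (card (S \<inter> {0..<N})) / real N) \<le> 1"
    using count_below_le[of S N] by (cases "N = 0") (simp_all add: count_below_def)
qed

lemma upper_density_sumset:
  assumes \<delta>: "0 < \<delta>"
  shows "upper_density (sliding_set \<delta> r + sliding_set \<delta> r) = 1"
proof (rule antisym[OF upper_density_le_1])
  define \<kappa> where "\<kappa> m = m * (r + 2)" for m
  define S where "S = sliding_set \<delta> r + sliding_set \<delta> r"
  have \<kappa>: "strict_mono \<kappa>" by (simp add: strict_mono_Suc_iff \<kappa>_def)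
  have "1 - 2 * (1/2) ^ \<kappa> m \<le> real (count_below S (cutoff (Suc (\<kappa> m)))) / real (cutoff (Suc (\<kappa> m)))" for m
  proof -
    define N where "N = cutoff (Suc (\<kappa> m))"
    have N: "N > 0" by (simp add: N_def cutoff_pos)
    have dvd: "(r + 2) dvd \<kappa> m" by (simp only: \<kappa>_def dvd_triv_right)
    have "{2 * cutoff (\<kappa> m)..<N} \<subseteq> S \<inter> {0..<N}"
      using sumset_contains_stage[OF \<delta> dvd] by (auto simp: S_def N_def)
    then have "card {2 * cutoff (\<kappa> m)..<N} \<le> count_below S N"
      unfolding count_below_def by (intro card_mono) auto
    then have "real N - 2 * real (cutoff (\<kappa> m)) \<le> real (count_below S N)" by simp
    moreover have "real (cutoff (\<kappa> m)) \<le> (1/2) ^ \<kappa> m * real N"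
      by (rule cutoff_le_half_power) (simp add: N_def)
    ultimately have "(1 - 2 * (1/2) ^ \<kappa> m) * real N \<le> real (count_below S N)"
      by (simp add: algebra_simps)
    then show ?thesis using N by (simp add: pos_le_divide_eq N_def)
  qed
  moreover have "strict_mono (\<lambda>m. cutoff (Suc (\<kappa> m)))"
    using \<kappa> by (simp add: strict_mono_def cutoff_less_iff)
  moreover have "(\<lambda>m. 1 - 2 * (1/2) ^ \<kappa> m) \<longlonglongrightarrow> (1::real)"
    using tendsto_diff[OF tendsto_const LIMSEQ_subseq_LIMSEQ[OF tendsto_const_half_power[of 2] \<kappa>], of 1]
    by (simp add: comp_def)
  ultimately have "ereal 1 \<le> upper_density S"
    by (intro upper_density_ge_subseq[where s = "\<lambda>m. cutoff (Suc (\<kappa> m))"]) auto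
  then show "1 \<le> upper_density (sliding_set \<delta> r + sliding_set \<delta> r)"
    by (simp add: S_def one_ereal_def)
qed

lemma lower_density_sumset:
  assumes \<delta>: "0 < \<delta>" "\<delta> \<le> 1/2" and r: "1 \<le> r"
  shows "lower_density (sliding_set \<delta> r + sliding_set \<delta> r) \<le> ereal (real r * (2 * \<delta>) ^ (r - 1))"
proof -
  \<comment> \<open>The stages just before those with an added interval.\<close>
  define \<kappa> where "\<kappa> m = m * (r + 2) + (r + 1)" for m
  define C where "C = 2 + real r * (4 * real r * 2 ^ r + 1)"
  define S where "S = sliding_set \<delta> r + sliding_set \<delta> r"
  have \<kappa>: "strict_mono \<kappa>" by (simp add: strict_mono_Suc_iff \<kappa>_def)
  have dvd: "(r + 2) dvd Suc (\<kappa> m)" for m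
  proof -
    have "Suc (\<kappa> m) = Suc m * (r + 2)" by (simp add: \<kappa>_def)
    then show ?thesis by (simp only: dvd_triv_right)
  qed
  have "eventually (\<lambda>m. (1/2) ^ m < \<delta>) sequentially"
    using order_tendstoD(2)[OF tendsto_const_half_power[of 1] \<delta>(1)] by simp
  then have "eventually (\<lambda>m. real (count_below S (cutoff (Suc (\<kappa> m)))) / real (cutoff (Suc (\<kappa> m)))
      \<le> real r * (2 * \<delta>) ^ (r - 1) + C * (1/2) ^ \<kappa> m) sequentially"
  proof eventually_elim
    case (elim m)
    have "1 \<le> \<delta> * 2 ^ m" using elim by (simp add: power_divide field_simps)
    also have "\<dots> \<le> \<delta> * 2 ^ (Suc (\<kappa> m) - r)"
      using \<delta> by (intro mult_left_mono power_increasing) (auto simp: \<kappa>_def)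
    finally show ?case
      using sumset_count_le[OF \<delta> _ r _ dvd] by (simp add: S_def C_def \<kappa>_def)
  qed
  moreover have "strict_mono (\<lambda>m. cutoff (Suc (\<kappa> m)))"
    using \<kappa> by (simp add: strict_mono_def cutoff_less_iff)
  moreover have "(\<lambda>m. real r * (2 * \<delta>) ^ (r - 1) + C * (1/2) ^ \<kappa> m)
      \<longlonglongrightarrow> real r * (2 * \<delta>) ^ (r - 1)"
    using tendsto_add[OF tendsto_const LIMSEQ_subseq_LIMSEQ[OF tendsto_const_half_power[of C] \<kappa>],
        of "real r * (2 * \<delta>) ^ (r - 1)"]
    by (simp add: comp_def)
  ultimately show ?thesis
    unfolding S_def by (intro lower_density_le_subseq[where s = "\<lambda>m. cutoff (Suc (\<kappa> m))"])
qed

theorem theorem1p2: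
  fixes r :: nat and \<delta> :: real
  assumes "r \<ge> 2" and "0 < \<delta>" and "\<delta> < 1/4"
  shows "\<exists>A :: nat set. admits_density A \<and> asymptotic_density A = ereal (\<delta> ^ r)
           \<and> upper_density (A + A) = 1
           \<and> lower_density (A + A) \<le> ereal ((real r + 1) * (2 * \<delta>) ^ (r - 1))"
proof (intro exI conjI)
  have "(\<lambda>N. ereal (real (card (sliding_set \<delta> r \<inter> {0..<N})) / real N)) \<longlonglongrightarrow> ereal (\<delta> ^ r)"
    using sliding_set_density[of \<delta> r] assms by (simp add: count_below_def)
  then have lower: "lower_density (sliding_set \<delta> r) = ereal (\<delta> ^ r)"
    and upper: "upper_density (sliding_set \<delta> r) = ereal (\<delta> ^ r)"
    by (simp_all add: lower_density_def upper_density_def lim_imp_Liminf lim_imp_Limsup)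
  show "admits_density (sliding_set \<delta> r)"
    by (simp add: admits_density_def lower upper)
  show "asymptotic_density (sliding_set \<delta> r) = ereal (\<delta> ^ r)"
    by (simp add: asymptotic_density_def lower)
  show "upper_density (sliding_set \<delta> r + sliding_set \<delta> r) = 1"
    using assms by (intro upper_density_sumset)
  have "lower_density (sliding_set \<delta> r + sliding_set \<delta> r) \<le> ereal (real r * (2 * \<delta>) ^ (r - 1))"
    using assms by (intro lower_density_sumset) auto
  also have "\<dots> \<le> ereal ((real r + 1) * (2 * \<delta>) ^ (r - 1))"
    using assms by (simp add: mult_right_mono)
  finally show "lower_density (sliding_set \<delta> r + sliding_set \<delta> r)
      \<le> ereal ((real r + 1) * (2 * \<delta>) ^ (r - 1))" .
qed

end
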